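(* Let $d\ge2$, $c>0$, $\beta>0$, and $L\ge2$. Let $\mathcal{H}^{\mathrm{Lap}}$ be the RKHS of the Laplace kernel $k^{\mathrm{Lap}}(\mathbf{x},\mathbf{z})=e^{-c\sqrt{1-\mathbf{x}^T\mathbf{z}}}$ on $\mathbb{S}^{d-1}$, and $\mathcal{H}^{\mathrm{FC}_\beta(m)}$ the RKHS of $k^{\mathrm{FC}_\beta(m)}$ restricted to $\mathbb{S}^{d-1}$. Then, as sets of functions, $\mathcal{H}^{\mathrm{Lap}}=\mathcal{H}^{\mathrm{FC}_\beta(2)}\subseteq\mathcal{H}^{\mathrm{FC}_\beta(L)}$.
   Context: NTK definition: Fix $\beta\ge 0$. For nonzero $\mathbf{x},\mathbf{z}\in\mathbb{R}^d$ define recursively $\Sigma^{(0)}(\mathbf{x},\mathbf{z})=\mathbf{x}^T\mathbf{z}$, $\Theta^{(0)}(\mathbf{x},\mathbf{z})=\mathbf{x}^T\mathbf{z}+\beta^2$, and for $h\ge 1$, with $\lambda^{(h-1)}=\Sigma^{(h-1)}(\mathbf{x},\mathbf{z})/\sqrt{\Sigma^{(h-1)}(\mathbf{x},\mathbf{x})\Sigma^{(h-1)}(\mathbf{z},\mathbf{z})}$, $\Sigma^{(h)}(\mathbf{x},\mathbf{z})=\frac{\lambda^{(h-1)}(\pi-\arccos\lambda^{(h-1)})+\sqrt{1-(\lambda^{(h-1)})^2}}{\pi}\sqrt{\Sigma^{(h-1)}(\mathbf{x},\mathbf{x})\Sigma^{(h-1)}(\mathbf{z},\mathbf{z})}$,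 $\dot\Sigma^{(h)}(\mathbf{x},\mathbf{z})=\frac{\pi-\arccos\lambda^{(h-1)}}{\pi}$, $\Theta^{(h)}=\Theta^{(h-1)}\dot\Sigma^{(h)}+\Sigma^{(h)}+\beta^2$. For $L\ge2$, $k^{\mathrm{FC}_\beta(L)}:=\Theta^{(L-1)}$ (NTK of an $L$-layer fully connected ReLU network with bias initialized at zero). For a zonal positive definite kernel on $\mathbb{S}^{d-1}$ with Mercer expansion $\sum_k\lambda_k\sum_{j=1}^{N(d,k)}Y_{k,j}(\mathbf{x})Y_{k,j}(\mathbf{z})$ ($Y_{k,j}$ orthonormal spherical harmonics w.r.t. the uniform measure, all $\lambda_k>0$), its RKHS is $\{f=\sum_{k,j}\alpha_{k,j}Y_{k,j}:\sum_{k,j}\alpha_{k,j}^2/\lambda_k<\infty\}$. *)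

theory Defs
  imports "HOL-Analysis.Analysis"
begin

section \<open>NTK of a fully connected ReLU network (bias initialised at zero)\<close>

primrec ntk_Sigma :: "nat \<Rightarrow> 'a::real_inner \<Rightarrow> 'a \<Rightarrow> real" where
  "ntk_Sigma 0 x z = x \<bullet> z"
| "ntk_Sigma (Suc h) x z =
     (let s = sqrt (ntk_Sigma h x x * ntk_Sigma h z z);
          lam = ntk_Sigma h x z / s
      in (lam * (pi - arccos lam) + sqrt (1 - lam\<^sup>2)) / pi * s)"

definition ntk_Sigma_dot :: "nat \<Rightarrow> 'a::real_inner \<Rightarrow> 'a \<Rightarrow> real" where
  "ntk_Sigma_dot h x z =
     (let lam = ntk_Sigma (h - 1) x z / sqrt (ntk_Sigma (h - 1) x x * ntk_Sigma (h - 1) z z)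
      in (pi - arccos lam) / pi)"

primrec ntk_Theta :: "real \<Rightarrow> nat \<Rightarrow> 'a::real_inner \<Rightarrow> 'a \<Rightarrow> real" where
  "ntk_Theta \<beta> 0 x z = x \<bullet> z + \<beta>\<^sup>2"
| "ntk_Theta \<beta> (Suc h) x z =
     ntk_Theta \<beta> h x z * ntk_Sigma_dot (Suc h) x z + ntk_Sigma (Suc h) x z + \<beta>\<^sup>2"

definition k_FC :: "real \<Rightarrow> nat \<Rightarrow> 'a::real_inner \<Rightarrow> 'a \<Rightarrow> real" where
  "k_FC \<beta> L x z = ntk_Theta \<beta> (L - 1) x z"

definition k_Lap :: "real \<Rightarrow> 'a::real_inner \<Rightarrow> 'a \<Rightarrow> real" where
  "k_Lap c x z = exp (- c * sqrt (1 - x \<bullet> z))"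

section \<open>RKHS of a kernel on a set S (Moore-Aronszajn construction), as a set of functions\<close>

text \<open>Finite combinations sum_i a_i k(., x_i) are represented by lists of pairs (a_i, x_i).\<close>

definition kcomb_eval :: "('a \<Rightarrow> 'a \<Rightarrow> real) \<Rightarrow> (real \<times> 'a) list \<Rightarrow> 'a \<Rightarrow> real" where
  "kcomb_eval k ps y = (\<Sum>p\<leftarrow>ps. fst p * k (snd p) y)"

definition kcomb_sqnorm :: "('a \<Rightarrow> 'a \<Rightarrow> real) \<Rightarrow> (real \<times> 'a) list \<Rightarrow> real" where
  "kcomb_sqnorm k ps = (\<Sum>p\<leftarrow>ps. \<Sum>q\<leftarrow>ps. fst p * fst q * k (snd p) (snd q))"

definition kcomb_diff :: "(real \<times> 'a) list \<Rightarrow> (real \<times> 'a) list \<Rightarrow> (real \<times> 'a) list" where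
  "kcomb_diff ps qs = ps @ map (\<lambda>(a, x). (- a, x)) qs"

text \<open>f belongs to the RKHS of k on S iff f vanishes off S (functions are regarded as
  functions on S) and f is the pointwise limit on S of a sequence of finite combinations
  of kernel sections k(., x), x in S, which is Cauchy in the RKHS norm.\<close>
definition rkhs :: "('a \<Rightarrow> 'a \<Rightarrow> real) \<Rightarrow> 'a set \<Rightarrow> ('a \<Rightarrow> real) set" where
  "rkhs k S = {f. (\<forall>x. x \<notin> S \<longrightarrow> f x = 0) \<and>
     (\<exists>g :: nat \<Rightarrow> (real \<times> 'a) list.
        (\<forall>n. snd ` set (g n) \<subseteq> S) \<and>
        (\<forall>e>0. \<exists>N. \<forall>m\<ge>N. \<forall>n\<ge>N. kcomb_sqnorm k (kcomb_diff (g m) (g n)) < e) \<and>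
        (\<forall>x\<in>S. (\<lambda>n. kcomb_eval k (g n) x) \<longlonglongrightarrow> f x))}"

end

theory Submission
  imports Defs
begin

text \<open>
  If \<open>C k\<^sub>2 - k\<^sub>1\<close> is positive semidefinite, then the RKHS of \<open>k\<^sub>1\<close> is contained in that of \<open>k\<^sub>2\<close>.
  On the sphere all kernels are functions of \<open>t = x \<bullet> z\<close>, and a function with nonnegative Taylor
  coefficients at \<open>0\<close> gives a positive semidefinite kernel in every dimension, so it suffices to
  compare Taylor coefficients; no spherical harmonics are needed. All comparisons go through
  \<open>1 + g\<close> with \<open>g(t) = 1 - sqrt (1 - t)\<close>.

  Laplace: the kernel is \<open>exp (-c) * exp (c * g)\<close>, and \<open>g\<^sup>2 = 2 g - t\<close> yields
  \<open>g ^ Suc n \<le> 2 ^ n * g\<close> coefficientwise, hence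
  \<open>1 + c g \<le> exp (c g) \<le> 1 + (exp (2 c) - 1) / 2 * g\<close> coefficientwise.

  Two layers: the non-polynomial part of the kernel is
  \<open>(\<beta>\<^sup>2 arcsin t + 2 t arcsin t + sqrt (1 - t\<^sup>2)) / \<pi>\<close>. Its odd coefficients come from \<open>\<beta>\<^sup>2 arcsin t\<close>
  (this is where \<open>\<beta> > 0\<close> enters), its even ones from the rest, and both are comparable with
  those of \<open>g\<close>.

  More layers: \<open>\<Theta>\<^bsub>h+1\<^esub> - \<Theta>\<^bsub>h\<^esub> / 2\<close> has nonnegative coefficients, because the derivative kernel
  \<open>(\<pi> - arccos u) / \<pi>\<close> is \<open>1/2 + arcsin u / \<pi>\<close>.
\<close>

section \<open>Inclusion of reproducing kernel Hilbert spaces\<close>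

text \<open>The combination acts here as a weighted sum of point evaluations; for \<open>F\<close>
  in the RKHS, this is the inner product of \<open>F\<close> with the combination, by the
  reproducing property.\<close>

definition kcomb_pair :: "('a \<Rightarrow> real) \<Rightarrow> (real \<times> 'a) list \<Rightarrow> real" where
  "kcomb_pair F ps = (\<Sum>p\<leftarrow>ps. fst p * F (snd p))"

text \<open>The RKHS inner product of two combinations, phrased through \<open>kcomb_pair\<close> so
  that linearity in both slots comes from one functional.\<close>

definition kcomb_inner :: "('a \<Rightarrow> 'a \<Rightarrow> real) \<Rightarrow> (real \<times> 'a) list \<Rightarrow> (real \<times> 'a) list \<Rightarrow> real" where
  "kcomb_inner k ps qs = kcomb_pair (kcomb_eval k ps) qs"

definition kcomb_scale :: "real \<Rightarrow> (real \<times> 'a) list \<Rightarrow> (real \<times> 'a) list" where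
  "kcomb_scale s ps = map (\<lambda>(a, x). (s * a, x)) ps"

definition psd_kernel :: "('a \<Rightarrow> 'a \<Rightarrow> real) \<Rightarrow> 'a set \<Rightarrow> bool" where
  "psd_kernel k S \<longleftrightarrow> (\<forall>x\<in>S. \<forall>y\<in>S. k x y = k y x) \<and>
     (\<forall>ps. snd ` set ps \<subseteq> S \<longrightarrow> 0 \<le> kcomb_sqnorm k ps)"

section \<open>Bilinear calculus of finite kernel combinations\<close>

lemma kcomb_pair_append: "kcomb_pair F (ps @ qs) = kcomb_pair F ps + kcomb_pair F qs"
  by (simp add: kcomb_pair_def)

lemma kcomb_pair_scale: "kcomb_pair F (kcomb_scale s ps) = s * kcomb_pair F ps"
  by (induction ps) (auto simp: kcomb_pair_def kcomb_scale_def algebra_simps)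

lemma kcomb_eval_eq_pair: "kcomb_eval k ps = (\<lambda>y. kcomb_pair (\<lambda>x. k x y) ps)"
  by (simp add: kcomb_eval_def kcomb_pair_def fun_eq_iff)

lemma kcomb_pair_add: "kcomb_pair (\<lambda>x. F x + G x) ps = kcomb_pair F ps + kcomb_pair G ps"
  by (induction ps) (auto simp: kcomb_pair_def algebra_simps)

lemma kcomb_pair_cmult: "kcomb_pair (\<lambda>x. s * F x) ps = s * kcomb_pair F ps"
  by (induction ps) (auto simp: kcomb_pair_def algebra_simps)

lemma kcomb_pair_commute:
  "kcomb_pair (\<lambda>x. kcomb_pair (\<lambda>y. F x y) qs) ps = kcomb_pair (\<lambda>y. kcomb_pair (\<lambda>x. F x y) ps) qs"
proof (induction ps)
  case Nil
  show ?case
    by (induction qs) (auto simp: kcomb_pair_def)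
next
  case (Cons p ps)
  have "kcomb_pair G (p # ps) = fst p * G (snd p) + kcomb_pair G ps" for G :: "'a \<Rightarrow> real"
    by (simp add: kcomb_pair_def)
  then show ?case
    by (simp add: Cons.IH kcomb_pair_add kcomb_pair_cmult)
qed

lemma kcomb_pair_cong: "(\<And>x. x \<in> snd ` set ps \<Longrightarrow> F x = G x) \<Longrightarrow> kcomb_pair F ps = kcomb_pair G ps"
  unfolding kcomb_pair_def by (rule arg_cong[where f = sum_list], rule map_cong) auto

lemma kcomb_pair_tendsto:
  assumes "\<And>x. x \<in> snd ` set ps \<Longrightarrow> (\<lambda>n. F n x) \<longlonglongrightarrow> G x"
  shows "(\<lambda>n. kcomb_pair (F n) ps) \<longlonglongrightarrow> kcomb_pair G ps"
  using assms by (induction ps) (auto simp: kcomb_pair_def intro!: tendsto_intros)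

lemma kcomb_sqnorm_eq_pair: "kcomb_sqnorm k ps = kcomb_pair (\<lambda>x. kcomb_pair (k x) ps) ps"
  by (simp add: kcomb_sqnorm_def kcomb_pair_def sum_list_const_mult[symmetric] mult.assoc)

lemma kcomb_sqnorm_eq_inner: "kcomb_sqnorm k ps = kcomb_inner k ps ps"
  unfolding kcomb_sqnorm_eq_pair kcomb_inner_def kcomb_eval_eq_pair by (rule kcomb_pair_commute)

lemma kcomb_eval_eq_inner: "kcomb_eval k ps x = kcomb_inner k ps [(1, x)]"
  by (simp add: kcomb_inner_def kcomb_pair_def)

lemma kcomb_inner_append_right:
  "kcomb_inner k ps (qs @ rs) = kcomb_inner k ps qs + kcomb_inner k ps rs"
  by (simp add: kcomb_inner_def kcomb_pair_append)

lemma kcomb_inner_scale_right: "kcomb_inner k ps (kcomb_scale s qs) = s * kcomb_inner k ps qs"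
  by (simp add: kcomb_inner_def kcomb_pair_scale)

lemma kcomb_inner_append_left:
  "kcomb_inner k (ps @ qs) rs = kcomb_inner k ps rs + kcomb_inner k qs rs"
  by (simp add: kcomb_inner_def kcomb_eval_eq_pair kcomb_pair_append kcomb_pair_add)

lemma kcomb_inner_scale_left: "kcomb_inner k (kcomb_scale s ps) qs = s * kcomb_inner k ps qs"
  by (simp add: kcomb_inner_def kcomb_eval_eq_pair kcomb_pair_scale kcomb_pair_cmult)

lemma kcomb_inner_commute:
  assumes "psd_kernel k S" "snd ` set ps \<subseteq> S" "snd ` set qs \<subseteq> S"
  shows "kcomb_inner k ps qs = kcomb_inner k qs ps"
proof -
  have "kcomb_inner k ps qs = kcomb_pair (\<lambda>y. kcomb_pair (\<lambda>x. k y x) ps) qs"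
    unfolding kcomb_inner_def kcomb_eval_eq_pair
    by (intro kcomb_pair_cong) (use assms in \<open>auto simp: psd_kernel_def subset_iff\<close>)
  also have "\<dots> = kcomb_inner k qs ps"
    unfolding kcomb_inner_def kcomb_eval_eq_pair by (rule kcomb_pair_commute)
  finally show ?thesis .
qed

lemma kcomb_diff_eq: "kcomb_diff ps qs = ps @ kcomb_scale (- 1) qs"
  by (simp add: kcomb_diff_def kcomb_scale_def)

lemma snd_set_kcomb_scale [simp]: "snd ` set (kcomb_scale s ps) = snd ` set ps"
  by (force simp: kcomb_scale_def image_iff)

lemma kcomb_sqnorm_scale: "kcomb_sqnorm k (kcomb_scale s ps) = s\<^sup>2 * kcomb_sqnorm k ps"
  by (simp add: kcomb_sqnorm_eq_inner kcomb_inner_scale_left kcomb_inner_scale_right power2_eq_square)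

lemma kcomb_sqnorm_append_scale:
  assumes "psd_kernel k S" "snd ` set ps \<subseteq> S" "snd ` set qs \<subseteq> S"
  shows "kcomb_sqnorm k (ps @ kcomb_scale s qs)
    = kcomb_sqnorm k ps + 2 * s * kcomb_inner k ps qs + s\<^sup>2 * kcomb_sqnorm k qs"
  using kcomb_inner_commute[OF assms]
  by (simp add: kcomb_sqnorm_eq_inner kcomb_inner_append_left kcomb_inner_append_right
      kcomb_inner_scale_left kcomb_inner_scale_right power2_eq_square algebra_simps)

lemma kcomb_sqnorm_nonneg: "psd_kernel k S \<Longrightarrow> snd ` set ps \<subseteq> S \<Longrightarrow> 0 \<le> kcomb_sqnorm k ps"
  by (simp add: psd_kernel_def)

text \<open>Discriminant argument: the squared norm of \<open>ps + s * qs\<close> is a nonnegative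
  quadratic polynomial in \<open>s\<close>. A possibly degenerate form forces the case split on
  \<open>B = 0\<close>.\<close>

lemma kcomb_Cauchy_Schwarz:
  assumes "psd_kernel k S" "snd ` set ps \<subseteq> S" "snd ` set qs \<subseteq> S"
  shows "(kcomb_inner k ps qs)\<^sup>2 \<le> kcomb_sqnorm k ps * kcomb_sqnorm k qs"
proof -
  define A B I where "A = kcomb_sqnorm k ps" and "B = kcomb_sqnorm k qs" and "I = kcomb_inner k ps qs"
  have quad: "0 \<le> A + 2 * s * I + s\<^sup>2 * B" for s
    using kcomb_sqnorm_append_scale[OF assms, of s] assms
    unfolding A_def B_def I_def by (metis kcomb_sqnorm_nonneg set_append image_Un le_sup_iff snd_set_kcomb_scale)
  have "0 \<le> B"
    using assms by (simp add: B_def kcomb_sqnorm_nonneg)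
  have "I\<^sup>2 \<le> A * B"
  proof (cases "B = 0")
    case True
    have "I = 0"
    proof (rule ccontr)
      assume "I \<noteq> 0"
      \<comment> \<open>At this \<open>s\<close> the polynomial, affine because
        \<open>B = 0\<close>, takes the value -1.\<close>
      then show False
        using quad[of "- (A + 1) / (2 * I)"] True by (simp add: field_simps)
    qed
    with True show ?thesis by simp
  next
    case False
    \<comment> \<open>\<open>- I / B\<close> minimises the quadratic polynomial.\<close>
    with \<open>0 \<le> B\<close> have "0 < B" by simp
    with quad[of "- I / B"] show ?thesis
      by (simp add: field_simps power2_eq_square)
  qed
  then show ?thesis
    by (simp add: A_def B_def I_def)
qed

text \<open>The approximating combinations have bounded norms from some index on, so Cauchy-Schwarz
  bounds their inner products with \<open>ps\<close> uniformly, and these converge to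
  \<open>kcomb_pair f ps\<close>.\<close>

lemma rkhs_bounded_functional:
  assumes psd: "psd_kernel k S" and f: "f \<in> rkhs k S"
  obtains M where "0 \<le> M" "\<And>ps. snd ` set ps \<subseteq> S \<Longrightarrow> (kcomb_pair f ps)\<^sup>2 \<le> M * kcomb_sqnorm k ps"
proof -
  obtain g where g: "(\<forall>n. snd ` set (g n) \<subseteq> S) \<and>
      (\<forall>e>0. \<exists>N. \<forall>m\<ge>N. \<forall>n\<ge>N. kcomb_sqnorm k (kcomb_diff (g m) (g n)) < e) \<and>
      (\<forall>x\<in>S. (\<lambda>n. kcomb_eval k (g n) x) \<longlonglongrightarrow> f x)"
    using f unfolding rkhs_def mem_Collect_eq by (elim conjE exE) (rule that, intro conjI)
  have gS: "snd ` set (g n) \<subseteq> S" for n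
    using g by simp
  have lim: "(\<lambda>n. kcomb_eval k (g n) x) \<longlonglongrightarrow> f x" if "x \<in> S" for x
    using g that by simp
  have "\<exists>N. \<forall>m\<ge>N. \<forall>n\<ge>N. kcomb_sqnorm k (kcomb_diff (g m) (g n)) < 1"
    using g[THEN conjunct2, THEN conjunct1, rule_format, of 1] by simp
  then obtain N where N: "\<And>n. n \<ge> N \<Longrightarrow> kcomb_sqnorm k (kcomb_diff (g n) (g N)) < 1"
    by blast
  define M where "M = 2 * (1 + kcomb_sqnorm k (g N))"
  have M0: "0 \<le> M"
    using kcomb_sqnorm_nonneg[OF psd gS, of N] by (simp add: M_def)
  have bnd: "kcomb_sqnorm k (g n) \<le> M" if "n \<ge> N" for n
  proof -
    \<comment> \<open>Parallelogram law for \<open>g n - g N\<close> and \<open>g N\<close>, whose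
      sum is \<open>g n\<close> and whose difference is \<open>g n - 2 * g N\<close>; dropping the
      square of the latter gives the bound \<open>M\<close>.\<close>
    have "0 \<le> kcomb_sqnorm k (g n @ kcomb_scale (- 2) (g N))"
      using gS[of n] gS[of N] by (intro kcomb_sqnorm_nonneg[OF psd]) (simp add: image_Un)
    moreover note kcomb_sqnorm_append_scale[OF psd gS gS, of n "- 2" N]
      kcomb_sqnorm_append_scale[OF psd gS gS, of n "- 1" N] N[OF that]
    ultimately show ?thesis
      by (simp add: M_def kcomb_diff_eq)
  qed
  have "(kcomb_pair f ps)\<^sup>2 \<le> M * kcomb_sqnorm k ps" if ps: "snd ` set ps \<subseteq> S" for ps
  proof (rule LIMSEQ_le_const2)
    have "(\<lambda>n. kcomb_inner k (g n) ps) \<longlonglongrightarrow> kcomb_pair f ps"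
      unfolding kcomb_inner_def using lim ps by (intro kcomb_pair_tendsto) blast
    then show "(\<lambda>n. (kcomb_inner k (g n) ps)\<^sup>2) \<longlonglongrightarrow> (kcomb_pair f ps)\<^sup>2"
      by (intro tendsto_intros)
    show "\<exists>N. \<forall>n\<ge>N. (kcomb_inner k (g n) ps)\<^sup>2 \<le> M * kcomb_sqnorm k ps"
    proof (intro exI allI impI)
      fix n assume "n \<ge> N"
      show "(kcomb_inner k (g n) ps)\<^sup>2 \<le> M * kcomb_sqnorm k ps"
        using kcomb_Cauchy_Schwarz[OF psd gS ps, of n]
          mult_right_mono[OF bnd[OF \<open>n \<ge> N\<close>] kcomb_sqnorm_nonneg[OF psd ps]] by linarith
    qed
  qed
  with M0 show thesis by (rule that)
qed

text \<open>Riesz representation without completing the space: a sequence that minimises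
  \<^term>\<open>kcomb_sqnorm k ps - 2 * kcomb_pair f ps\<close> is Cauchy by the parallelogram law, and near
  the infimum the first variation of this quadratic functional is small.\<close>

lemma bounded_functional_in_rkhs:
  assumes psd: "psd_kernel k S" and off: "\<And>x. x \<notin> S \<Longrightarrow> f x = 0" and "0 \<le> M"
    and bnd: "\<And>ps. snd ` set ps \<subseteq> S \<Longrightarrow> (kcomb_pair f ps)\<^sup>2 \<le> M * kcomb_sqnorm k ps"
  shows "f \<in> rkhs k S"
proof -
  define J where "J ps = kcomb_sqnorm k ps - 2 * kcomb_pair f ps" for ps
  define X where "X = {ps :: (real \<times> 'a) list. snd ` set ps \<subseteq> S}"
  define I where "I = (INF ps\<in>X. J ps)"
  have J_lower: "- M \<le> J ps" if "ps \<in> X" for ps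
  proof -
    let ?N = "kcomb_sqnorm k ps"
    have N: "0 \<le> ?N"
      using that psd by (simp add: X_def kcomb_sqnorm_nonneg)
    \<comment> \<open>Arithmetic-geometric mean inequality:
      \<open>2 * sqrt (M * N) \<le> N + M\<close>.\<close>
    have "(2 * kcomb_pair f ps)\<^sup>2 \<le> 4 * (M * ?N)"
      using bnd[of ps] that by (simp add: X_def power_mult_distrib)
    also have "\<dots> \<le> (?N + M)\<^sup>2"
      using zero_le_power2[of "?N - M"] by (simp add: power2_eq_square algebra_simps)
    finally have "2 * kcomb_pair f ps \<le> ?N + M"
      by (rule power2_le_imp_le) (use N \<open>0 \<le> M\<close> in simp)
    then show ?thesis by (simp add: J_def)
  qed
  have bdd: "bdd_below (J ` X)"
    using J_lower by (rule bdd_belowI2)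
  have I_le: "I \<le> J ps" if "ps \<in> X" for ps
    unfolding I_def using bdd that by (rule cINF_lower)
  have "X \<noteq> {}"
    by (auto simp: X_def intro!: exI[of _ "[]"])
  have "\<exists>ps\<in>X. J ps < I + 1 / Suc n" for n
    using cINF_less_iff[OF \<open>X \<noteq> {}\<close> bdd, of "I + 1 / Suc n"] by (simp add: I_def)
  then obtain v where vX: "\<And>n. v n \<in> X" and vJ: "\<And>n. J (v n) < I + 1 / Suc n"
    by metis
  have vS: "snd ` set (v n) \<subseteq> S" for n
    using vX by (simp add: X_def)
  \<comment> \<open>The linear parts of \<open>J\<close> cancel against four times the midpoint.
    Writing \<open>kcomb_scale 1 qs\<close> keeps the sum in the shape of
    \<open>kcomb_sqnorm_append_scale\<close>.\<close>
  have par: "kcomb_sqnorm k (kcomb_diff ps qs)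
      = 2 * J ps + 2 * J qs - 4 * J (kcomb_scale (1/2) (ps @ kcomb_scale 1 qs))"
    if "snd ` set ps \<subseteq> S" "snd ` set qs \<subseteq> S" for ps qs
    using kcomb_sqnorm_append_scale[OF psd that, of 1] kcomb_sqnorm_append_scale[OF psd that, of "-1"]
    by (simp add: J_def kcomb_diff_eq kcomb_sqnorm_scale kcomb_pair_scale kcomb_pair_append
        power2_eq_square field_simps)
  have diff: "kcomb_sqnorm k (kcomb_diff (v m) (v n)) < 2 / Suc m + 2 / Suc n" for m n
  proof -
    have "kcomb_scale (1/2) (v m @ kcomb_scale 1 (v n)) \<in> X"
      using vS[of m] vS[of n] by (simp add: X_def image_Un)
    from I_le[OF this] show ?thesis
      using par[OF vS vS, of m n] vJ[of m] vJ[of n] by simp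
  qed
  have "\<exists>N. \<forall>m\<ge>N. \<forall>n\<ge>N. kcomb_sqnorm k (kcomb_diff (v m) (v n)) < e" if "e > 0" for e
  proof -
    have "0 < e / 4"
      using that by simp
    then obtain N where N: "1 / real (Suc N) < e / 4"
      by (rule nat_approx_posE)
    have small: "2 / real (Suc n) < e / 2" if "n \<ge> N" for n
    proof -
      have "1 / real (Suc n) \<le> 1 / real (Suc N)"
        using that by (intro frac_le) auto
      with N show ?thesis by simp
    qed
    show ?thesis
    proof (intro exI[of _ N] allI impI)
      fix m n assume "N \<le> m" "N \<le> n"
      from small[OF this(1)] small[OF this(2)] diff[of m n]
      show "kcomb_sqnorm k (kcomb_diff (v m) (v n)) < e" by linarith
    qed
  qed
  moreover have "(\<lambda>n. kcomb_eval k (v n) x) \<longlonglongrightarrow> f x" if x: "x \<in> S" for x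
  proof -
    define B where "B = kcomb_sqnorm k [(1, x)]"
    define D where "D n = kcomb_eval k (v n) x - f x" for n
    have xS: "snd ` set [(1::real, x)] \<subseteq> S"
      using x by simp
    have B0: "0 \<le> B"
      unfolding B_def by (rule kcomb_sqnorm_nonneg[OF psd xS])
    have D2: "(D n)\<^sup>2 \<le> (B + 1) * (1 / Suc n)" for n
    proof -
      \<comment> \<open>A nearly optimal step from \<open>v n\<close> along the kernel section at
        \<open>x\<close>, where \<open>D n\<close> is half the first variation of \<open>J\<close>.
        The denominator \<open>B + 1\<close> stays positive even if
        \<open>k x x = 0\<close>.\<close>
      define s where "s = - D n / (B + 1)"
      have "v n @ kcomb_scale s [(1, x)] \<in> X"
        using vS[of n] xS by (simp add: X_def image_Un)
      from I_le[OF this] have "I \<le> J (v n) + 2 * s * D n + s\<^sup>2 * B"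
        using kcomb_sqnorm_append_scale[OF psd vS xS, of n s]
        by (simp add: J_def D_def B_def kcomb_pair_append kcomb_pair_scale kcomb_eval_eq_inner
            algebra_simps) (simp add: kcomb_pair_def)
      then have "0 \<le> 1 / Suc n + 2 * s * D n + s\<^sup>2 * B"
        using vJ[of n] by linarith
      also have "s\<^sup>2 * B \<le> s\<^sup>2 * (B + 1)"
        by (simp add: mult_left_mono)
      also have "s\<^sup>2 * (B + 1) = - s * D n"
      proof -
        have "s * (B + 1) = - D n"
          using B0 by (simp add: s_def)
        then show ?thesis
          by (simp add: power2_eq_square mult.assoc)
      qed
      finally have "- s * D n \<le> 1 / Suc n"
        by simp
      moreover have "- s * D n = (D n)\<^sup>2 / (B + 1)"
        by (simp add: s_def power2_eq_square)
      ultimately have "(D n)\<^sup>2 / (B + 1) \<le> 1 / Suc n"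
        by simp
      then show ?thesis
        using B0 by (simp add: pos_divide_le_eq mult.commute)
    qed
    have "(\<lambda>n. (B + 1) * (1 / real (Suc n))) \<longlonglongrightarrow> (B + 1) * 0"
      by (intro tendsto_intros LIMSEQ_Suc lim_1_over_n)
    then have "(\<lambda>n. (D n)\<^sup>2) \<longlonglongrightarrow> 0"
      by (intro tendsto_sandwich[of "\<lambda>_. 0" "\<lambda>n. (D n)\<^sup>2"]) (use D2 in auto)
    then have "D \<longlonglongrightarrow> 0"
      using tendsto_real_sqrt[of "\<lambda>n. (D n)\<^sup>2" 0] by (simp add: tendsto_rabs_zero_iff)
    then show ?thesis
      unfolding D_def[abs_def] by (rule LIM_zero_cancel)
  qed
  ultimately show ?thesis
    unfolding rkhs_def mem_Collect_eq by (intro conjI allI impI exI[of _ v] ballI off vS)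
qed

text \<open>Membership amounts to boundedness of \<open>kcomb_pair f\<close> in the kernel norm, and
  a bound \<open>M\<close> for \<open>k1\<close> turns into \<open>M * C\<close> for
  \<open>k2\<close>.\<close>

lemma rkhs_subset:
  assumes "psd_kernel k1 S" "psd_kernel k2 S" "0 \<le> C"
    and "\<And>ps. snd ` set ps \<subseteq> S \<Longrightarrow> kcomb_sqnorm k1 ps \<le> C * kcomb_sqnorm k2 ps"
  shows "rkhs k1 S \<subseteq> rkhs k2 S"
proof
  fix f assume f: "f \<in> rkhs k1 S"
  obtain M where M: "0 \<le> M" "\<And>ps. snd ` set ps \<subseteq> S \<Longrightarrow> (kcomb_pair f ps)\<^sup>2 \<le> M * kcomb_sqnorm k1 ps"
    using rkhs_bounded_functional[OF assms(1) f] by blast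
  show "f \<in> rkhs k2 S"
  proof (rule bounded_functional_in_rkhs[OF assms(2)])
    show "f x = 0" if "x \<notin> S" for x
      using f that by (simp add: rkhs_def)
    show "0 \<le> M * C"
      using M(1) assms(3) by simp
    show "(kcomb_pair f ps)\<^sup>2 \<le> M * C * kcomb_sqnorm k2 ps" if "snd ` set ps \<subseteq> S" for ps
      using M(2)[OF that] mult_left_mono[OF assms(4)[OF that] M(1)] by (simp add: mult.assoc)
  qed
qed

section \<open>Positive definite functions of the inner product\<close>

text \<open>By Schoenberg's theorem these are the functions that are positive definite on the unit spheres
  of all dimensions; the values outside \<open>[-1, 1]\<close> are irrelevant.\<close>

inductive schoenberg :: "(real \<Rightarrow> real) \<Rightarrow> bool" where
  const: "0 \<le> a \<Longrightarrow> schoenberg (\<lambda>_. a)"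
| ident: "schoenberg (\<lambda>t. t)"
| add: "schoenberg f \<Longrightarrow> schoenberg g \<Longrightarrow> schoenberg (\<lambda>t. f t + g t)"
| mult: "schoenberg f \<Longrightarrow> schoenberg g \<Longrightarrow> schoenberg (\<lambda>t. f t * g t)"
| lim: "(\<And>n. schoenberg (F n)) \<Longrightarrow> (\<And>t. t \<in> {-1..1} \<Longrightarrow> (\<lambda>n. F n t) \<longlonglongrightarrow> f t) \<Longrightarrow> schoenberg f"

text \<open>The limit rule applied to a constant sequence.\<close>

lemma schoenberg_cong:
  assumes "schoenberg f" "\<And>t. t \<in> {-1..1} \<Longrightarrow> f t = g t"
  shows "schoenberg g"
  by (rule schoenberg.lim[of "\<lambda>_. f"]) (use assms in auto)

lemma schoenberg_cmult: "0 \<le> a \<Longrightarrow> schoenberg f \<Longrightarrow> schoenberg (\<lambda>t. a * f t)"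
  by (intro schoenberg.mult schoenberg.const)

lemma schoenberg_power: "schoenberg f \<Longrightarrow> schoenberg (\<lambda>t. f t ^ n)"
  by (induction n) (auto intro: schoenberg.const schoenberg.mult)

lemma schoenberg_sum:
  "finite I \<Longrightarrow> (\<And>i. i \<in> I \<Longrightarrow> schoenberg (f i)) \<Longrightarrow> schoenberg (\<lambda>t. \<Sum>i\<in>I. f i t)"
  by (induction I rule: finite_induct) (auto intro: schoenberg.const schoenberg.add)

text \<open>Keeps inner functions within [-1, 1], which makes composition possible.\<close>

lemma schoenberg_bound: "schoenberg f \<Longrightarrow> t \<in> {-1..1} \<Longrightarrow> \<bar>f t\<bar> \<le> f 1"
proof (induction arbitrary: t rule: schoenberg.induct)
  case (add f g)
  from add.IH[OF add.prems] show ?case by linarith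
next
  case (mult f g)
  from mult.IH[OF mult.prems] show ?case
    by (simp add: abs_mult mult_mono')
next
  case (lim F f)
  show ?case
  proof (rule LIMSEQ_le)
    show "(\<lambda>n. \<bar>F n t\<bar>) \<longlonglongrightarrow> \<bar>f t\<bar>"
      using lim by (intro tendsto_intros) auto
    show "(\<lambda>n. F n 1) \<longlonglongrightarrow> f 1"
      using lim by auto
    show "\<exists>N. \<forall>n\<ge>N. \<bar>F n t\<bar> \<le> F n 1"
      using lim by blast
  qed
qed auto

text \<open>Induction on the outer function. The bound on \<open>g\<close> serves the limit case,
  where convergence is known on [-1, 1] only.\<close>

lemma schoenberg_compose:
  assumes "schoenberg f" "schoenberg g" "g 1 \<le> 1"
  shows "schoenberg (\<lambda>t. f (g t))"
  using assms(1)
proof (induction rule: schoenberg.induct)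
  case (lim F f)
  show ?case
  proof (rule schoenberg.lim[OF lim.IH])
    fix t :: real assume "t \<in> {-1..1}"
    then have "g t \<in> {-1..1}"
      using schoenberg_bound[OF assms(2)] assms(3) by (fastforce simp: abs_le_iff)
    then show "(\<lambda>n. F n (g t)) \<longlonglongrightarrow> f (g t)"
      by (rule lim.hyps)
  qed
qed (use assms in \<open>auto intro: schoenberg.intros\<close>)

text \<open>Convergence of the series at the endpoints is avoided: the dilated function
  \<open>f (r n * t)\<close> with \<open>r n < 1\<close> is a limit of partial sums on all of
  [-1, 1], and continuity allows \<open>r n\<close> to tend to 1.\<close>

lemma schoenberg_power_series:
  fixes p :: "nat \<Rightarrow> real"
  assumes nonneg: "\<And>n. 0 \<le> p n" and cont: "continuous_on {-1..1} f"
    and sums: "\<And>t. \<bar>t\<bar> < 1 \<Longrightarrow> (\<lambda>n. p n * t ^ n) sums f t"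
  shows "schoenberg f"
proof (rule schoenberg.lim)
  define r where "r n = 1 - 1 / real (Suc n)" for n
  have r: "0 \<le> r n" "r n < 1" for n
    by (auto simp: r_def)
  have rt: "\<bar>r n * t\<bar> < 1" if "t \<in> {-1..1}" for n t
  proof -
    have "\<bar>r n * t\<bar> \<le> r n * 1"
      unfolding abs_mult using r[of n] that by (intro mult_mono) auto
    with r(2)[of n] show ?thesis by linarith
  qed
  show "schoenberg (\<lambda>t. f (r n * t))" for n
  proof (rule schoenberg.lim)
    show "schoenberg (\<lambda>t. \<Sum>i<N. p i * r n ^ i * t ^ i)" for N
      using nonneg r(1) by (intro schoenberg_sum schoenberg_cmult schoenberg_power schoenberg.ident) auto
    show "(\<lambda>N. \<Sum>i<N. p i * r n ^ i * t ^ i) \<longlonglongrightarrow> f (r n * t)" if "t \<in> {-1..1}" for t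
      using sums[OF rt[OF that]] by (simp add: sums_def power_mult_distrib mult.assoc)
  qed
  have "r \<longlonglongrightarrow> 1 - 0"
    unfolding r_def by (intro tendsto_intros LIMSEQ_Suc lim_1_over_n)
  show "(\<lambda>n. f (r n * t)) \<longlonglongrightarrow> f t" if "t \<in> {-1..1}" for t
  proof (rule continuous_on_tendsto_compose[OF cont])
    show "(\<lambda>n. r n * t) \<longlonglongrightarrow> t"
      using tendsto_mult_right[OF \<open>r \<longlonglongrightarrow> 1 - 0\<close>, of t] by simp
    show "\<forall>\<^sub>F n in sequentially. r n * t \<in> {-1..1}"
      using rt[OF that] by (auto intro!: always_eventually simp: abs_less_iff less_imp_le)
  qed fact
qed

section \<open>From functions of the inner product to positive semidefinite kernels\<close>

lemma kcomb_sqnorm_add: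
  "kcomb_sqnorm (\<lambda>x z. k x z + l x z) ps = kcomb_sqnorm k ps + kcomb_sqnorm l ps"
  by (simp add: kcomb_sqnorm_eq_pair kcomb_pair_add)

lemma kcomb_sqnorm_cmult: "kcomb_sqnorm (\<lambda>x z. a * k x z) ps = a * kcomb_sqnorm k ps"
  by (simp add: kcomb_sqnorm_eq_pair kcomb_pair_cmult)

lemma kcomb_sqnorm_cong:
  "(\<And>x z. x \<in> snd ` set ps \<Longrightarrow> z \<in> snd ` set ps \<Longrightarrow> k x z = l x z) \<Longrightarrow> kcomb_sqnorm k ps = kcomb_sqnorm l ps"
  unfolding kcomb_sqnorm_eq_pair by (intro kcomb_pair_cong) auto

text \<open>Expanding \<open>x \<bullet> z\<close> in coordinates lets each coordinate be absorbed
  into the coefficients of the combination.\<close>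

lemma kcomb_sqnorm_inner_mult:
  fixes k :: "'a::euclidean_space \<Rightarrow> 'a \<Rightarrow> real"
  shows "kcomb_sqnorm (\<lambda>x z. (x \<bullet> z) * k x z) ps
    = (\<Sum>i\<in>Basis. kcomb_sqnorm k (map (\<lambda>(a, x). (a * (x \<bullet> i), x)) ps))"
proof -
  have pair: "kcomb_pair F (map (\<lambda>(a, x). (a * (x \<bullet> i), x)) ps) = kcomb_pair (\<lambda>x. (x \<bullet> i) * F x) ps"
    for F and i :: 'a and ps
    by (induction ps) (auto simp: kcomb_pair_def)
  have sum: "kcomb_pair (\<lambda>x. \<Sum>i\<in>Basis. G i x) ps = (\<Sum>i\<in>Basis. kcomb_pair (G i) ps)"
    for G :: "'a \<Rightarrow> 'a \<Rightarrow> real" and ps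
    by (induction ps) (auto simp: kcomb_pair_def sum.distrib sum_distrib_left)
  have "kcomb_sqnorm (\<lambda>x z. (x \<bullet> z) * k x z) ps
      = kcomb_pair (\<lambda>x. kcomb_pair (\<lambda>z. \<Sum>i\<in>Basis. (x \<bullet> i) * ((z \<bullet> i) * k x z)) ps) ps"
    unfolding kcomb_sqnorm_eq_pair
    by (subst euclidean_inner) (simp add: sum_distrib_right mult.assoc)
  also have "\<dots> = (\<Sum>i\<in>Basis. kcomb_pair (\<lambda>x. (x \<bullet> i) * kcomb_pair (\<lambda>z. (z \<bullet> i) * k x z) ps) ps)"
    by (simp only: sum kcomb_pair_cmult)
  finally show ?thesis
    by (simp only: kcomb_sqnorm_eq_pair pair)
qed

text \<open>Multiplying by an arbitrary kernel makes the induction close under products of functions,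
  so the Schur product theorem is not needed.\<close>

lemma psd_kernel_schoenberg_mult:
  fixes k :: "'a::euclidean_space \<Rightarrow> 'a \<Rightarrow> real"
  assumes "schoenberg f" "S \<subseteq> cball 0 1" "psd_kernel k S"
  shows "psd_kernel (\<lambda>x z. f (x \<bullet> z) * k x z) S"
  using assms(1,3)
proof (induction arbitrary: k rule: schoenberg.induct)
  case (const a)
  then show ?case
    by (auto simp: psd_kernel_def kcomb_sqnorm_cmult)
next
  case ident
  show ?case
    unfolding psd_kernel_def
  proof (intro conjI ballI allI impI)
    fix ps :: "(real \<times> 'a) list" assume "snd ` set ps \<subseteq> S"
    then show "0 \<le> kcomb_sqnorm (\<lambda>x z. (x \<bullet> z) * k x z) ps"
      unfolding kcomb_sqnorm_inner_mult
      by (intro sum_nonneg kcomb_sqnorm_nonneg[OF ident]) (auto simp: image_subset_iff)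
  qed (use ident in \<open>auto simp: psd_kernel_def inner_commute\<close>)
next
  case (add f g)
  have "psd_kernel (\<lambda>x z. f (x \<bullet> z) * k x z) S" "psd_kernel (\<lambda>x z. g (x \<bullet> z) * k x z) S"
    using add by blast+
  then show ?case
    by (auto simp: psd_kernel_def distrib_right kcomb_sqnorm_add)
next
  case (mult f g)
  then show ?case
    by (simp add: mult.assoc)
next
  case (lim F f)
  have IH: "psd_kernel (\<lambda>x z. F n (x \<bullet> z) * k x z) S" for n
    using lim by blast
  have inS: "x \<bullet> z \<in> {-1..1}" if "x \<in> S" "z \<in> S" for x z
  proof -
    have "norm x * norm z \<le> 1 * 1"
      using that assms(2) by (intro mult_mono) (auto simp: subset_iff)
    with Cauchy_Schwarz_ineq2[of x z] show ?thesis by auto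
  qed
  show ?case
    unfolding psd_kernel_def
  proof (intro conjI ballI allI impI)
    fix ps :: "(real \<times> 'a) list" assume ps: "snd ` set ps \<subseteq> S"
    show "0 \<le> kcomb_sqnorm (\<lambda>x z. f (x \<bullet> z) * k x z) ps"
    proof (rule LIMSEQ_le_const)
      show "(\<lambda>n. kcomb_sqnorm (\<lambda>x z. F n (x \<bullet> z) * k x z) ps)
          \<longlonglongrightarrow> kcomb_sqnorm (\<lambda>x z. f (x \<bullet> z) * k x z) ps"
        unfolding kcomb_sqnorm_eq_pair using ps
        by (intro kcomb_pair_tendsto tendsto_intros lim.hyps inS) auto
      show "\<exists>N. \<forall>n\<ge>N. 0 \<le> kcomb_sqnorm (\<lambda>x z. F n (x \<bullet> z) * k x z) ps"
        using kcomb_sqnorm_nonneg[OF IH ps] by blast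
    qed
  qed (use lim.prems in \<open>auto simp: psd_kernel_def inner_commute\<close>)
qed

text \<open>The quadratic form is the square of the sum of the coefficients.\<close>

lemma psd_kernel_one: "psd_kernel (\<lambda>_ _. 1) S"
proof -
  have "kcomb_sqnorm (\<lambda>_ _. 1) ps = (kcomb_pair (\<lambda>_. 1) ps)\<^sup>2" for ps :: "(real \<times> 'a) list"
    using kcomb_pair_cmult[of "kcomb_pair (\<lambda>_. 1) ps" "\<lambda>_. 1" ps]
    by (simp add: kcomb_sqnorm_eq_pair power2_eq_square)
  then show ?thesis
    by (simp add: psd_kernel_def)
qed

lemma psd_kernel_schoenberg:
  fixes S :: "'a::euclidean_space set"
  assumes "schoenberg f" "S \<subseteq> cball 0 1"
  shows "psd_kernel (\<lambda>x z. f (x \<bullet> z)) S"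
  using psd_kernel_schoenberg_mult[OF assms psd_kernel_one] by simp

lemma psd_kernel_cong:
  assumes "psd_kernel l S" "\<And>x z. x \<in> S \<Longrightarrow> z \<in> S \<Longrightarrow> k x z = l x z"
  shows "psd_kernel k S"
proof -
  have "kcomb_sqnorm k ps = kcomb_sqnorm l ps" if "snd ` set ps \<subseteq> S" for ps
    using assms(2) that by (intro kcomb_sqnorm_cong) blast
  with assms show ?thesis
    by (simp add: psd_kernel_def)
qed

text \<open>Reduces each inclusion to one domination between functions of \<open>t\<close>: the
  quadratic form of \<open>C * l - k\<close> is nonnegative.\<close>

lemma rkhs_schoenberg_subset:
  fixes S :: "'a::euclidean_space set"
  assumes S: "S \<subseteq> cball 0 1" and f: "schoenberg f" and g: "schoenberg g"
    and "0 \<le> C" and dom: "schoenberg (\<lambda>t. C * g t - f t)"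
    and k: "\<And>x z. x \<in> S \<Longrightarrow> z \<in> S \<Longrightarrow> k x z = f (x \<bullet> z)"
    and l: "\<And>x z. x \<in> S \<Longrightarrow> z \<in> S \<Longrightarrow> l x z = g (x \<bullet> z)"
  shows "rkhs k S \<subseteq> rkhs l S"
proof (rule rkhs_subset)
  show "psd_kernel k S" "psd_kernel l S"
    using psd_kernel_cong[OF psd_kernel_schoenberg[OF f S]] k
      psd_kernel_cong[OF psd_kernel_schoenberg[OF g S]] l by blast+
  fix ps :: "(real \<times> 'a) list" assume ps: "snd ` set ps \<subseteq> S"
  then have "0 \<le> kcomb_sqnorm (\<lambda>x z. C * g (x \<bullet> z) - f (x \<bullet> z)) ps"
    by (rule kcomb_sqnorm_nonneg[OF psd_kernel_schoenberg[OF dom S]])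
  moreover have "kcomb_sqnorm (\<lambda>x z. (C * g (x \<bullet> z) - f (x \<bullet> z)) + f (x \<bullet> z)) ps
      = kcomb_sqnorm (\<lambda>x z. C * g (x \<bullet> z) - f (x \<bullet> z)) ps + kcomb_sqnorm (\<lambda>x z. f (x \<bullet> z)) ps"
    by (rule kcomb_sqnorm_add)
  moreover have "kcomb_sqnorm k ps = kcomb_sqnorm (\<lambda>x z. f (x \<bullet> z)) ps"
    "kcomb_sqnorm l ps = kcomb_sqnorm (\<lambda>x z. g (x \<bullet> z)) ps"
    using k l ps by (intro kcomb_sqnorm_cong; blast)+
  ultimately show "kcomb_sqnorm k ps \<le> C * kcomb_sqnorm l ps"
    by (simp add: kcomb_sqnorm_cmult)
qed fact

section \<open>Taylor coefficients\<close>

text \<open>The Taylor coefficients of \<open>1 / sqrt (1 - t)\<close>, i.e. \<open>(2n choose n) / 4^n\<close>.\<close>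

primrec rsqrt_coeff :: "nat \<Rightarrow> real" where
  "rsqrt_coeff 0 = 1"
| "rsqrt_coeff (Suc n) = rsqrt_coeff n * (2 * real n + 1) / (2 * real n + 2)"

text \<open>Link to the binomial series with exponent -1/2; the sign arises from expanding at
  \<open>- t\<close>.\<close>

lemma rsqrt_coeff_gbinomial: "rsqrt_coeff n = (- 1) ^ n * ((- 1/2) gchoose n)"
proof (induction n)
  case (Suc n)
  have "((- 1/2 :: real) gchoose Suc n) = - ((2 * real n + 1) / (2 * real n + 2)) * ((- 1/2) gchoose n)"
    using gbinomial_mult_1[of "- 1/2 :: real" n] by (simp add: field_simps)
  with Suc show ?case
    by (simp only: rsqrt_coeff.simps power_Suc) simp
qed simp

lemma rsqrt_coeff_nonneg: "0 \<le> rsqrt_coeff n"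
  by (induction n) auto

lemma rsqrt_coeff_antimono: "m \<le> n \<Longrightarrow> rsqrt_coeff n \<le> rsqrt_coeff m"
proof (induction rule: dec_induct)
  case (step n)
  have "rsqrt_coeff (Suc n) \<le> rsqrt_coeff n"
    using rsqrt_coeff_nonneg[of n] by (simp add: field_simps)
  with step show ?case by simp
qed simp

text \<open>The coefficients decay only like \<open>1 / sqrt n\<close>, so doubling the index costs
  a bounded factor. Equality holds at \<open>m = 0\<close>; afterwards one growth ratio on the left
  is at most the product of two on the right.\<close>

lemma rsqrt_coeff_double: "rsqrt_coeff m \<le> 8/3 * rsqrt_coeff (2 * m + 2)"
proof (induction m)
  case (Suc m)
  define r where "r = real m"
  have r0: "0 \<le> r" by (simp add: r_def)
  let ?a = "(2 * r + 1) / (2 * r + 2)"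
    and ?b = "(4 * r + 5) / (4 * r + 6) * ((4 * r + 7) / (4 * r + 8))"
  have ab: "?a \<le> ?b"
  proof -
    \<comment> \<open>The right side exceeds the left by \<open>14 * r + 22\<close>.\<close>
    have "(2 * r + 1) * ((4 * r + 6) * (4 * r + 8)) \<le> (4 * r + 5) * (4 * r + 7) * (2 * r + 2)"
      using r0 by (simp add: algebra_simps)
    then have "?a \<le> (4 * r + 5) * (4 * r + 7) / ((4 * r + 6) * (4 * r + 8))"
      using r0 by (subst pos_divide_le_eq, simp, subst times_divide_eq_left, subst pos_le_divide_eq) auto
    then show ?thesis by simp
  qed
  have "rsqrt_coeff (Suc m) = rsqrt_coeff m * ?a"
    by (simp add: r_def)
  also have "\<dots> \<le> (8/3 * rsqrt_coeff (2 * m + 2)) * ?b"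
    using ab r0 Suc rsqrt_coeff_nonneg by (intro mult_mono) auto
  also have "\<dots> = 8/3 * (rsqrt_coeff (2 * m + 2) * ?b)"
    by (simp only: mult.assoc)
  also have "rsqrt_coeff (2 * m + 2) * ?b = rsqrt_coeff (2 * Suc m + 2)"
    by (simp add: r_def algebra_simps)
  finally show ?case .
qed (simp add: numeral_2_eq_2)

lemma sums_rsqrt:
  fixes t :: real
  assumes "\<bar>t\<bar> < 1"
  shows "(\<lambda>n. rsqrt_coeff n * t ^ n) sums (1 / sqrt (1 - t))"
proof -
  have "(\<lambda>n. ((- 1/2) gchoose n) * (- t) ^ n) sums (1 + - t) powr (- 1/2)"
    using gen_binomial_real[of "- t" "- 1/2"] assms by simp
  moreover have "(1 + - t) powr (- 1/2) = 1 / sqrt (1 - t)"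
    using assms powr_minus_divide[of "1 - t" "1/2"] by (simp add: powr_half_sqrt)
  moreover have "((- 1/2) gchoose n) * (- t) ^ n = rsqrt_coeff n * t ^ n" for n
    by (simp add: rsqrt_coeff_gbinomial power_minus[of t] mult_ac)
  ultimately show ?thesis by simp
qed

section \<open>Termwise integration and the expansions obtained from it\<close>

primrec integ_coeff :: "(nat \<Rightarrow> real) \<Rightarrow> nat \<Rightarrow> real" where
  "integ_coeff p 0 = 0"
| "integ_coeff p (Suc n) = p n / real (Suc n)"

text \<open>The termwise antiderivative \<open>G\<close> and \<open>f\<close> have the same
  derivative on (-1, 1), hence differ by a constant, which \<open>G 0 = 0\<close>
  identifies.\<close>

lemma integrate_power_series:
  fixes f f' :: "real \<Rightarrow> real" and p :: "nat \<Rightarrow> real"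
  assumes sums: "\<And>t. \<bar>t\<bar> < 1 \<Longrightarrow> (\<lambda>n. p n * t ^ n) sums f' t"
    and deriv: "\<And>t. \<bar>t\<bar> < 1 \<Longrightarrow> (f has_real_derivative f' t) (at t)"
    and t: "\<bar>t\<bar> < 1"
  shows "(\<lambda>n. integ_coeff p n * t ^ n) sums (f t - f 0)"
proof -
  define q where "q n = p n / real (Suc n)" for n
  have q: "q n * real (Suc n) = p n" for n
    by (simp add: q_def)
  define G where "G t = (\<Sum>n. q n * t ^ Suc n)" for t
  have dG: "(G has_real_derivative f' t) (at t)" if "\<bar>t\<bar> < 1" for t
    using DERIV_power_series'[of 1 q t] sums that
    unfolding G_def q by (auto simp: sums_iff abs_less_iff)
  have "\<forall>x\<in>{-1<..<1}. ((\<lambda>t. f t - G t) has_real_derivative 0) (at x within {-1<..<1})"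
    by (auto intro!: derivative_eq_intros DERIV_subset[OF deriv] DERIV_subset[OF dG] simp: abs_less_iff)
  then obtain c where c: "\<And>x. x \<in> {-1<..<1} \<Longrightarrow> f x - G x = c"
    using has_field_derivative_zero_constant[of "{-1<..<1 :: real}" "\<lambda>t. f t - G t"] by auto
  have "G 0 = 0"
    by (simp add: G_def)
  with c[of 0] c[of t] t have Gt: "G t = f t - f 0"
    by (auto simp: abs_less_iff)
  \<comment> \<open>Convergence at a radius beyond \<open>\<bar>t\<bar>\<close> yields absolute
    convergence at \<open>t\<close>, which dominates the integrated series.\<close>
  obtain r where r: "\<bar>t\<bar> < r" "r < 1"
    using dense t by blast
  have "summable (\<lambda>n. norm (p n * t ^ n))"
    using sums[of r] r by (intro powser_insidea[of p r]) (auto simp: sums_iff)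
  then have "summable (\<lambda>n. q n * t ^ Suc n)"
  proof (rule summable_comparison_test')
    fix n
    have "norm (q n * t ^ Suc n) = \<bar>p n * t ^ n\<bar> * (\<bar>t\<bar> / real (Suc n))"
      by (simp add: q_def abs_mult power_abs)
    also have "\<dots> \<le> \<bar>p n * t ^ n\<bar> * 1"
      using t by (intro mult_left_mono) (auto simp: divide_simps)
    finally show "norm (q n * t ^ Suc n) \<le> norm (p n * t ^ n)" by simp
  qed
  then have "(\<lambda>n. q n * t ^ Suc n) sums (f t - f 0)"
    by (simp add: sums_iff Gt[symmetric] G_def)
  \<comment> \<open>The coefficient at index 0 vanishes, so the sum may start at index 1.\<close>
  then show ?thesis
    by (subst sums_Suc_iff[symmetric, of "\<lambda>n. integ_coeff p n * t ^ n", simplified])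
      (simp add: q_def)
qed

abbreviation lap_gap :: "real \<Rightarrow> real" where
  "lap_gap t \<equiv> 1 - sqrt (1 - t)"

text \<open>The integrand is the expansion of the derivative
  \<open>1 / (2 * sqrt (1 - t))\<close>.\<close>

definition lap_gap_coeff :: "nat \<Rightarrow> real" where
  "lap_gap_coeff = integ_coeff (\<lambda>n. rsqrt_coeff n / 2)"

text \<open>The integrand expands \<open>1 / sqrt (1 - t^2)\<close>, a series in \<open>t^2\<close>,
  hence the zeros at odd indices.\<close>

definition arcsin_coeff :: "nat \<Rightarrow> real" where
  "arcsin_coeff = integ_coeff (\<lambda>n. if even n then rsqrt_coeff (n div 2) else 0)"

lemma sums_lap_gap:
  fixes t :: real
  assumes "\<bar>t\<bar> < 1"
  shows "(\<lambda>n. lap_gap_coeff n * t ^ n) sums lap_gap t"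
proof -
  have "(\<lambda>n. lap_gap_coeff n * t ^ n) sums (lap_gap t - lap_gap 0)"
    unfolding lap_gap_coeff_def
  proof (rule integrate_power_series[OF _ _ assms])
    fix t :: real assume t: "\<bar>t\<bar> < 1"
    show "(\<lambda>n. rsqrt_coeff n / 2 * t ^ n) sums (1 / sqrt (1 - t) / 2)"
      using sums_divide[OF sums_rsqrt[OF t], of 2] by simp
    show "(lap_gap has_real_derivative 1 / sqrt (1 - t) / 2) (at t)"
      using t by (auto intro!: derivative_eq_intros simp: field_simps)
  qed
  then show ?thesis by simp
qed

lemma sums_arcsin:
  fixes t :: real
  assumes "\<bar>t\<bar> < 1"
  shows "(\<lambda>n. arcsin_coeff n * t ^ n) sums arcsin t"
proof -
  have "(\<lambda>n. arcsin_coeff n * t ^ n) sums (arcsin t - arcsin 0)"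
    unfolding arcsin_coeff_def
  proof (rule integrate_power_series[OF _ _ assms])
    fix t :: real assume t: "\<bar>t\<bar> < 1"
    then have "\<bar>t\<^sup>2\<bar> < 1"
      by (simp add: abs_square_less_1)
    from sums_if[OF sums_zero sums_rsqrt[OF this]]
    have "(\<lambda>n. if even n then rsqrt_coeff (n div 2) * (t\<^sup>2) ^ (n div 2) else 0)
        sums (1 / sqrt (1 - t\<^sup>2))"
      by simp
    moreover have "(if even n then rsqrt_coeff (n div 2) * (t\<^sup>2) ^ (n div 2) else 0)
        = (if even n then rsqrt_coeff (n div 2) else 0) * t ^ n" for n
      by (simp add: power_mult[symmetric])
    ultimately show "(\<lambda>n. (if even n then rsqrt_coeff (n div 2) else 0) * t ^ n)
        sums inverse (sqrt (1 - t\<^sup>2))"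
      by (simp add: inverse_eq_divide)
    show "(arcsin has_real_derivative inverse (sqrt (1 - t\<^sup>2))) (at t)"
      using t by (intro DERIV_arcsin) auto
  qed
  then show ?thesis by simp
qed

text \<open>The non-polynomial part of \<open>kappa1\<close> is an antiderivative of arcsine up to
  the factor \<open>1 / pi\<close>; subtracting 1 normalises it at 0.\<close>

lemma sums_integral_arcsin:
  fixes t :: real
  assumes "\<bar>t\<bar> < 1"
  shows "(\<lambda>n. integ_coeff arcsin_coeff n * t ^ n) sums (t * arcsin t + sqrt (1 - t\<^sup>2) - 1)"
proof -
  let ?E = "\<lambda>t. t * arcsin t + sqrt (1 - t\<^sup>2)"
  have "(\<lambda>n. integ_coeff arcsin_coeff n * t ^ n) sums (?E t - ?E 0)"
  proof (rule integrate_power_series[OF sums_arcsin _ assms])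
    fix t :: real assume t: "\<bar>t\<bar> < 1"
    then have "t\<^sup>2 < 1"
      by (simp add: abs_square_less_1)
    with t show "(?E has_real_derivative arcsin t) (at t)"
      by (auto intro!: derivative_eq_intros simp: field_simps)
  qed
  then show ?thesis by simp
qed

lemma lap_gap_coeff_nonneg: "0 \<le> lap_gap_coeff n"
  by (cases n) (auto simp: lap_gap_coeff_def rsqrt_coeff_nonneg)

lemma arcsin_coeff_eq: "arcsin_coeff n = (if odd n then rsqrt_coeff (n div 2) / n else 0)"
  by (cases n) (auto simp: arcsin_coeff_def)

lemma arcsin_coeff_nonneg: "0 \<le> arcsin_coeff n"
  by (simp add: arcsin_coeff_eq rsqrt_coeff_nonneg)

lemma lap_gap_coeff_Suc: "lap_gap_coeff (Suc n) = rsqrt_coeff n / (2 * real n + 2)"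
  by (simp add: lap_gap_coeff_def field_simps)

text \<open>\<^const>\<open>arcsin_coeff\<close> lives on odd indices only; the sum of two neighbours picks the
  non-zero one.\<close>

lemma arcsin_coeff_pair_bounds:
  "lap_gap_coeff (Suc n) \<le> arcsin_coeff (Suc n) + arcsin_coeff n"
  "arcsin_coeff (Suc n) + arcsin_coeff n \<le> 8 * lap_gap_coeff (Suc n)"
proof -
  have "lap_gap_coeff (Suc n) \<le> arcsin_coeff (Suc n) + arcsin_coeff n \<and>
      arcsin_coeff (Suc n) + arcsin_coeff n \<le> 8 * lap_gap_coeff (Suc n)"
  proof (cases "even n")
    case True
    then obtain m where n: "n = 2 * m" by blast
    have "arcsin_coeff (Suc n) + arcsin_coeff n = rsqrt_coeff m / (2 * real m + 1)"
      by (simp add: n arcsin_coeff_eq add.commute)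
    moreover have "lap_gap_coeff (Suc n) = (rsqrt_coeff (2 * m) / 2) / (2 * real m + 1)"
      by (simp add: lap_gap_coeff_Suc n)
    moreover have 1: "rsqrt_coeff (2 * m) \<le> rsqrt_coeff m"
      "rsqrt_coeff (2 * m + 2) \<le> rsqrt_coeff (2 * m)"
      by (rule rsqrt_coeff_antimono; simp)+
    have "(rsqrt_coeff (2 * m) / 2) / (2 * real m + 1) \<le> rsqrt_coeff m / (2 * real m + 1)"
      using 1 rsqrt_coeff_nonneg[of m] by (intro divide_right_mono) linarith+
    moreover have "rsqrt_coeff m / (2 * real m + 1) \<le> (8 * (rsqrt_coeff (2 * m) / 2)) / (2 * real m + 1)"
      using 1 rsqrt_coeff_double[of m] rsqrt_coeff_nonneg[of "2 * m"]
      by (intro divide_right_mono) linarith+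
    ultimately show ?thesis
      by (simp only: times_divide_eq_right simp_thms)
  next
    case False
    then obtain m where n: "n = Suc (2 * m)" by (metis oddE Suc_eq_plus1)
    have "arcsin_coeff (Suc n) + arcsin_coeff n = rsqrt_coeff m / (2 * real m + 1)"
      by (simp add: n arcsin_coeff_eq add.commute)
    moreover have "lap_gap_coeff (Suc n) = rsqrt_coeff (2 * m + 1) / (4 * real m + 4)"
      by (simp add: lap_gap_coeff_Suc n)
    moreover have 1: "rsqrt_coeff (2 * m + 1) \<le> rsqrt_coeff m"
      "rsqrt_coeff (2 * m + 2) \<le> rsqrt_coeff (2 * m + 1)"
      by (rule rsqrt_coeff_antimono; simp)+
    have "rsqrt_coeff (2 * m + 1) / (4 * real m + 4) \<le> rsqrt_coeff m / (2 * real m + 1)"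
      using 1 rsqrt_coeff_nonneg by (intro frac_le) auto
    \<comment> \<open>This bound dictates the constant 8, with equality at \<open>m = 0\<close>. The
      recurrence moves index \<open>2 * m + 1\<close> to \<open>2 * m + 2\<close>, where
      \<open>rsqrt_coeff_double\<close> applies.\<close>
    moreover have "rsqrt_coeff m / (2 * real m + 1) \<le> 8 * (rsqrt_coeff (2 * m + 1) / (4 * real m + 4))"
    proof -
      let ?w = "rsqrt_coeff (2 * m + 1)" and ?r = "real m"
      have "rsqrt_coeff (2 * m + 2) = ?w * (4 * ?r + 3) / (4 * ?r + 4)"
        using rsqrt_coeff.simps(2)[of "2 * m + 1"]
        by (simp del: rsqrt_coeff.simps add: algebra_simps)
      then have double: "rsqrt_coeff (2 * m + 2) * (4 * ?r + 4) = (4 * ?r + 3) * ?w"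
        by (simp del: rsqrt_coeff.simps)
      have "rsqrt_coeff m * (4 * ?r + 4) \<le> 8/3 * rsqrt_coeff (2 * m + 2) * (4 * ?r + 4)"
        using rsqrt_coeff_double[of m] by (intro mult_right_mono) auto
      also have "\<dots> = 8/3 * (4 * ?r + 3) * ?w"
        by (simp only: mult.assoc double)
      also have "\<dots> \<le> 8 * (2 * ?r + 1) * ?w"
        using rsqrt_coeff_nonneg by (intro mult_right_mono) auto
      finally have "rsqrt_coeff m * (4 * ?r + 4) \<le> 8 * ?w * (2 * ?r + 1)"
        by (simp only: mult_ac)
      then show ?thesis
        by (subst pos_divide_le_eq, simp, subst times_divide_eq_right, subst times_divide_eq_left,
            subst pos_le_divide_eq) auto
    qed
    ultimately show ?thesis by simp
  qed
  then show "lap_gap_coeff (Suc n) \<le> arcsin_coeff (Suc n) + arcsin_coeff n"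
    "arcsin_coeff (Suc n) + arcsin_coeff n \<le> 8 * lap_gap_coeff (Suc n)" by auto
qed

lemma schoenberg_lap_gap: "schoenberg lap_gap"
  by (rule schoenberg_power_series[OF lap_gap_coeff_nonneg _ sums_lap_gap]) (auto intro!: continuous_intros)

text \<open>Induction on \<open>n\<close> with \<open>lap_gap\<^sup>2 = 2 lap_gap - t\<close>.\<close>

lemma schoenberg_lap_gap_power:
  "schoenberg (\<lambda>t. 2 ^ n * lap_gap t - lap_gap t ^ Suc n)"
proof (induction n)
  case 0
  show ?case by (simp add: schoenberg.const)
next
  case (Suc n)
  have "schoenberg (\<lambda>t. 2 ^ n * t + lap_gap t * (2 ^ n * lap_gap t - lap_gap t ^ Suc n))"
    by (intro schoenberg.add schoenberg.mult schoenberg_cmult schoenberg.ident schoenberg_lap_gap Suc) simp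
  then show ?case
  proof (rule schoenberg_cong)
    fix t :: real assume "t \<in> {-1..1}"
    then have "lap_gap t * lap_gap t = 2 * lap_gap t - t"
      by (simp add: algebra_simps)
    then have "t = 2 * lap_gap t - lap_gap t * lap_gap t"
      by linarith
    then have "2 ^ n * t = 2 ^ n * (2 * lap_gap t - lap_gap t * lap_gap t)"
      by (rule arg_cong)
    then show "2 ^ n * t + lap_gap t * (2 ^ n * lap_gap t - lap_gap t ^ Suc n)
        = 2 ^ Suc n * lap_gap t - lap_gap t ^ Suc (Suc n)"
      by (simp only: power_Suc right_diff_distrib mult_ac)
  qed
qed

text \<open>The exponential series without its first two terms is a limit of nonnegative
  combinations of powers of \<open>g\<close>.\<close>

lemma schoenberg_exp_minus_linear:
  assumes "schoenberg g" "0 \<le> c"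
  shows "schoenberg (\<lambda>t. exp (c * g t) - 1 - c * g t)"
proof (rule schoenberg.lim)
  show "schoenberg (\<lambda>t. \<Sum>i<N. (c ^ (i + 2) / fact (i + 2)) * g t ^ (i + 2))" for N
    using assms by (intro schoenberg_sum schoenberg_cmult schoenberg_power) auto
  show "(\<lambda>N. \<Sum>i<N. (c ^ (i + 2) / fact (i + 2)) * g t ^ (i + 2)) \<longlonglongrightarrow> exp (c * g t) - 1 - c * g t" for t
    using sums_split_initial_segment[OF exp_converges[of "c * g t"], of 2]
    by (simp add: sums_def numeral_2_eq_2 power_mult_distrib field_simps)
qed

text \<open>Weight \<open>schoenberg_lap_gap_power\<close> by the exponential coefficients and sum;
  since \<open>2 ^ i = 2 ^ Suc i / 2\<close>, the factors of \<open>lap_gap\<close> add up to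
  \<open>(exp (2 * c) - 1) / 2\<close>.\<close>

lemma schoenberg_linear_minus_exp_lap_gap:
  assumes "0 \<le> c"
  shows "schoenberg (\<lambda>t. 1 + (exp (2 * c) - 1) / 2 * lap_gap t - exp (c * lap_gap t))"
proof (rule schoenberg.lim)
  let ?a = "\<lambda>i. c ^ Suc i / fact (Suc i)"
  show "schoenberg (\<lambda>t. \<Sum>i<N. ?a i * (2 ^ i * lap_gap t - lap_gap t ^ Suc i))" for N
    using assms by (intro schoenberg_sum schoenberg_cmult schoenberg_lap_gap_power) auto
  fix t
  have shift: "(\<lambda>i. ?a i * x ^ Suc i) sums (exp (c * x) - 1)" for x
    using sums_split_initial_segment[OF exp_converges[of "c * x"], of 1]
    by (simp add: power_mult_distrib field_simps)
  have "(\<lambda>i. (?a i * 2 ^ Suc i) / 2 * lap_gap t) sums ((exp (c * 2) - 1) / 2 * lap_gap t)"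
    by (intro sums_mult2 sums_divide shift)
  from sums_diff[OF this shift[of "lap_gap t"]]
  have "(\<lambda>i. ?a i * (2 ^ i * lap_gap t - lap_gap t ^ Suc i))
      sums ((exp (c * 2) - 1) / 2 * lap_gap t - (exp (c * lap_gap t) - 1))"
    by (simp add: right_diff_distrib mult.assoc)
  then show "(\<lambda>N. \<Sum>i<N. ?a i * (2 ^ i * lap_gap t - lap_gap t ^ Suc i))
      \<longlonglongrightarrow> 1 + (exp (2 * c) - 1) / 2 * lap_gap t - exp (c * lap_gap t)"
    by (simp add: sums_def algebra_simps)
qed

section \<open>Neural tangent kernels on the sphere\<close>

lemma schoenberg_arcsin: "schoenberg arcsin"
  by (rule schoenberg_power_series[OF arcsin_coeff_nonneg continuous_on_arcsin' sums_arcsin])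

text \<open>The arc-cosine kernel of degree 0, as a function of the cosine.\<close>

definition kappa0 :: "real \<Rightarrow> real" where
  "kappa0 t = (pi - arccos t) / pi"

text \<open>The arc-cosine kernel of degree 1, normalised to the value 1 at 1.\<close>

definition kappa1 :: "real \<Rightarrow> real" where
  "kappa1 t = (t * (pi - arccos t) + sqrt (1 - t\<^sup>2)) / pi"

lemma kappa0_eq: "t \<in> {-1..1} \<Longrightarrow> kappa0 t = 1/2 + arcsin t / pi"
  by (simp add: kappa0_def arccos_arcsin_eq field_simps)

lemma kappa1_eq: "t \<in> {-1..1} \<Longrightarrow> kappa1 t = t / 2 + (t * arcsin t + sqrt (1 - t\<^sup>2)) / pi"
  by (simp add: kappa1_def arccos_arcsin_eq field_simps)

lemma kappa1_one: "kappa1 1 = 1"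
  by (simp add: kappa1_def)

lemma integ_coeff_nonneg: "(\<And>n. 0 \<le> p n) \<Longrightarrow> 0 \<le> integ_coeff p n"
  by (cases n) auto

lemma schoenberg_kappa1: "schoenberg kappa1"
proof -
  have "schoenberg (\<lambda>t. t * arcsin t + sqrt (1 - t\<^sup>2) - 1)"
    by (rule schoenberg_power_series[OF integ_coeff_nonneg[OF arcsin_coeff_nonneg] _ sums_integral_arcsin])
      (auto intro!: continuous_intros)
  \<comment> \<open>The constant 1 removed by the normalisation at 0 is restored as a nonnegative
    summand.\<close>
  then have "schoenberg (\<lambda>t. 1/2 * t + 1/pi * ((t * arcsin t + sqrt (1 - t\<^sup>2) - 1) + 1))"
    by (intro schoenberg.add schoenberg_cmult schoenberg.ident schoenberg.const) auto
  then show ?thesis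
    by (rule schoenberg_cong) (simp add: kappa1_eq)
qed

primrec sphere_Sigma :: "nat \<Rightarrow> real \<Rightarrow> real" where
  "sphere_Sigma 0 t = t"
| "sphere_Sigma (Suc h) t = kappa1 (sphere_Sigma h t)"

primrec sphere_Theta :: "real \<Rightarrow> nat \<Rightarrow> real \<Rightarrow> real" where
  "sphere_Theta \<beta> 0 t = t + \<beta>\<^sup>2"
| "sphere_Theta \<beta> (Suc h) t =
     sphere_Theta \<beta> h t * kappa0 (sphere_Sigma h t) + sphere_Sigma (Suc h) t + \<beta>\<^sup>2"

lemma sphere_Sigma_one: "sphere_Sigma h 1 = 1"
  by (induction h) (auto simp: kappa1_one)

text \<open>As \<open>kappa1\<close> fixes 1, the diagonal values stay 1 and the normalising root
  disappears. The induction generalises \<open>x\<close> and \<open>z\<close> to reach these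
  diagonal values.\<close>

lemma ntk_Sigma_sphere:
  assumes "norm x = 1" "norm z = 1"
  shows "ntk_Sigma h x z = sphere_Sigma h (x \<bullet> z)"
  using assms
proof (induction h arbitrary: x z)
  case (Suc h)
  have "ntk_Sigma h x x = 1" "ntk_Sigma h z z = 1"
    using Suc by (simp_all add: sphere_Sigma_one dot_square_norm)
  then show ?case
    by (simp add: Suc kappa1_def Let_def)
qed simp

lemma ntk_Theta_sphere:
  assumes "norm x = 1" "norm z = 1"
  shows "ntk_Theta \<beta> h x z = sphere_Theta \<beta> h (x \<bullet> z)"
proof (induction h)
  case (Suc h)
  have "ntk_Sigma h x x = 1" "ntk_Sigma h z z = 1"
    using assms by (simp_all add: ntk_Sigma_sphere sphere_Sigma_one dot_square_norm)
  then show ?case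
    using Suc ntk_Sigma_sphere[OF assms, of "Suc h"]
    by (simp add: ntk_Sigma_dot_def kappa0_def ntk_Sigma_sphere[OF assms] del: ntk_Sigma.simps)
qed simp

lemma schoenberg_sphere_Sigma: "schoenberg (sphere_Sigma h)"
proof (induction h)
  case 0
  show ?case by (simp add: schoenberg.ident)
next
  case (Suc h)
  show ?case
    using schoenberg_compose[OF schoenberg_kappa1 Suc] by (simp add: sphere_Sigma_one)
qed

lemma sphere_Theta_Suc_eq:
  assumes "t \<in> {-1..1}"
  shows "sphere_Theta \<beta> (Suc h) t = 1/2 * sphere_Theta \<beta> h t
    + (1/pi * (sphere_Theta \<beta> h t * arcsin (sphere_Sigma h t)) + sphere_Sigma (Suc h) t + \<beta>\<^sup>2)"
proof -
  have "sphere_Sigma h t \<in> {-1..1}"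
    using schoenberg_bound[OF schoenberg_sphere_Sigma assms, of h] by (simp add: sphere_Sigma_one abs_le_iff)
  then show ?thesis
    by (simp add: kappa0_eq algebra_simps)
qed

lemma schoenberg_sphere_Theta_step:
  assumes "schoenberg (sphere_Theta \<beta> h)"
  shows "schoenberg (\<lambda>t. 1/pi * (sphere_Theta \<beta> h t * arcsin (sphere_Sigma h t)) + sphere_Sigma (Suc h) t + \<beta>\<^sup>2)"
  by (intro schoenberg.add schoenberg_cmult schoenberg.mult schoenberg.const assms
      schoenberg_compose[OF schoenberg_arcsin] schoenberg_sphere_Sigma)
    (auto simp: sphere_Sigma_one)

lemma schoenberg_sphere_Theta: "schoenberg (sphere_Theta \<beta> h)"
proof (induction h)
  case 0
  show ?case
    by (auto intro!: schoenberg.add schoenberg.ident schoenberg.const)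
next
  case (Suc h)
  have "schoenberg (\<lambda>t. 1/2 * sphere_Theta \<beta> h t
      + (1/pi * (sphere_Theta \<beta> h t * arcsin (sphere_Sigma h t)) + sphere_Sigma (Suc h) t + \<beta>\<^sup>2))"
    by (intro schoenberg.add[OF schoenberg_cmult schoenberg_sphere_Theta_step] Suc) simp
  then show ?case
    by (rule schoenberg_cong) (simp only: sphere_Theta_Suc_eq)
qed

text \<open>Doubling the factor at each layer undoes the 1/2 split off by
  \<open>sphere_Theta_Suc_eq\<close>, leaving the earlier difference plus a positive definite
  remainder.\<close>

lemma schoenberg_sphere_Theta_growth:
  "schoenberg (\<lambda>t. 2 ^ n * sphere_Theta \<beta> (Suc n) t - sphere_Theta \<beta> 1 t)"
proof (induction n)
  case 0
  show ?case by (simp add: schoenberg.const)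
next
  case (Suc n)
  let ?R = "\<lambda>t. 1/pi * (sphere_Theta \<beta> (Suc n) t * arcsin (sphere_Sigma (Suc n) t))
    + sphere_Sigma (Suc (Suc n)) t + \<beta>\<^sup>2"
  have "schoenberg (\<lambda>t. 2 ^ Suc n * ?R t + (2 ^ n * sphere_Theta \<beta> (Suc n) t - sphere_Theta \<beta> 1 t))"
    by (rule schoenberg.add[OF schoenberg_cmult[OF _ schoenberg_sphere_Theta_step[OF schoenberg_sphere_Theta]] Suc])
      simp
  then show ?case
  proof (rule schoenberg_cong)
    fix t :: real assume t: "t \<in> {-1..1}"
    show "2 ^ Suc n * ?R t + (2 ^ n * sphere_Theta \<beta> (Suc n) t - sphere_Theta \<beta> 1 t)
        = 2 ^ Suc n * sphere_Theta \<beta> (Suc (Suc n)) t - sphere_Theta \<beta> 1 t"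
      unfolding sphere_Theta_Suc_eq[OF t, of _ "Suc n"] by (simp add: distrib_left del: sphere_Theta.simps sphere_Sigma.simps)
  qed
qed

section \<open>Taylor coefficients of the two-layer kernel compared with those of
  \<open>1 + lap_gap\<close>\<close>

primrec shift_coeff :: "(nat \<Rightarrow> real) \<Rightarrow> nat \<Rightarrow> real" where
  "shift_coeff p 0 = 0"
| "shift_coeff p (Suc n) = p n"

lemma sums_shift_coeff:
  fixes t :: real
  assumes "(\<lambda>n. p n * t ^ n) sums s"
  shows "(\<lambda>n. shift_coeff p n * t ^ n) sums (t * s)"
  using sums_mult[OF assms, of t]
  by (subst sums_Suc_iff[symmetric, of "\<lambda>n. shift_coeff p n * t ^ n", simplified]) (simp add: mult_ac)

text \<open>Both \<open>kappa0\<close> and \<open>kappa1\<close> contribute \<open>t / 2\<close> to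
  the linear term. The constant collects \<open>\<beta>^2 / 2\<close> from \<open>kappa0\<close>,
  the added bias \<open>\<beta>^2\<close>, and the value \<open>1 / pi\<close> of the integral term
  at 0.\<close>

definition fc2_coeff :: "real \<Rightarrow> nat \<Rightarrow> real" where
  "fc2_coeff \<beta> n = (if n = 0 then 3/2 * \<beta>\<^sup>2 + 1/pi else 0) + (if n = 1 then 1 else 0)
     + (\<beta>\<^sup>2 * arcsin_coeff n + shift_coeff arcsin_coeff n + integ_coeff arcsin_coeff n) / pi"

lemma sphere_Theta_1_eq:
  assumes "t \<in> {-1..1}"
  shows "sphere_Theta \<beta> 1 t = (3/2 * \<beta>\<^sup>2 + 1/pi) + t
    + (\<beta>\<^sup>2 * arcsin t + t * arcsin t + (t * arcsin t + sqrt (1 - t\<^sup>2) - 1)) / pi"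
  using assms by (simp add: kappa0_eq kappa1_eq field_simps)

lemma sums_sphere_Theta_1:
  assumes t: "\<bar>t\<bar> < 1"
  shows "(\<lambda>n. fc2_coeff \<beta> n * t ^ n) sums sphere_Theta \<beta> 1 t"
proof -
  have "(\<lambda>n. (if n = 0 then 3/2 * \<beta>\<^sup>2 + 1/pi else 0) + (if n = 1 then t ^ n else 0)
      + (\<beta>\<^sup>2 * (arcsin_coeff n * t ^ n) + shift_coeff arcsin_coeff n * t ^ n
        + integ_coeff arcsin_coeff n * t ^ n) / pi)
    sums ((3/2 * \<beta>\<^sup>2 + 1/pi) + t ^ 1
      + (\<beta>\<^sup>2 * arcsin t + t * arcsin t + (t * arcsin t + sqrt (1 - t\<^sup>2) - 1)) / pi)"
    by (intro sums_add sums_divide sums_mult sums_single sums_shift_coeff sums_arcsin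
        sums_integral_arcsin t)
  also have "(\<lambda>n. (if n = 0 then 3/2 * \<beta>\<^sup>2 + 1/pi else 0) + (if n = 1 then t ^ n else 0)
      + (\<beta>\<^sup>2 * (arcsin_coeff n * t ^ n) + shift_coeff arcsin_coeff n * t ^ n
        + integ_coeff arcsin_coeff n * t ^ n) / pi) = (\<lambda>n. fc2_coeff \<beta> n * t ^ n)"
    by (auto simp: fc2_coeff_def fun_eq_iff field_simps)
  finally show ?thesis
    using t by (subst sphere_Theta_1_eq) (auto simp: abs_less_iff)
qed

lemma sums_one_plus_lap_gap:
  assumes t: "\<bar>t\<bar> < 1"
  shows "(\<lambda>n. ((if n = 0 then 1 else 0) + lap_gap_coeff n) * t ^ n) sums (1 + lap_gap t)"
proof -
  have "(\<lambda>n. (if n = 0 then 1 else 0) + lap_gap_coeff n * t ^ n) sums (1 + lap_gap t)"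
    by (intro sums_add sums_single[of 0 "\<lambda>_. 1"] sums_lap_gap t)
  moreover have "(if n = 0 then 1 else 0) + lap_gap_coeff n * t ^ n
      = ((if n = 0 then 1 else 0) + lap_gap_coeff n) * t ^ n" for n
    by (simp add: distrib_right)
  ultimately show ?thesis by simp
qed

lemma continuous_on_sphere_Theta_1: "continuous_on {-1..1} (sphere_Theta \<beta> 1)"
proof (rule continuous_on_eq)
  show "continuous_on {-1..1} (\<lambda>t. (3/2 * \<beta>\<^sup>2 + 1/pi) + t
    + (\<beta>\<^sup>2 * arcsin t + t * arcsin t + (t * arcsin t + sqrt (1 - t\<^sup>2) - 1)) / pi)"
    by (auto intro!: continuous_intros)
qed (simp only: sphere_Theta_1_eq)

text \<open>Lets the shifted term control the integrated one, which equals it divided by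
  \<open>Suc n\<close>.\<close>

lemma integ_arcsin_coeff_bounds:
  "0 \<le> integ_coeff arcsin_coeff (Suc n)" "integ_coeff arcsin_coeff (Suc n) \<le> arcsin_coeff n"
  using arcsin_coeff_nonneg[of n] by (auto simp: field_simps)

text \<open>The factor \<open>pi\<close> clears the denominator. At positive indices it suffices to
  keep \<open>\<beta>^2 * ?a + ?b\<close>, whose two summands cover the odd and the even
  indices.\<close>

lemma fc2_coeff_lower:
  assumes "0 < \<beta>"
  shows "(if n = 0 then 1 else 0) + lap_gap_coeff n \<le> pi * (1 + 1 / \<beta>\<^sup>2) * fc2_coeff \<beta> n"
proof (cases n)
  case 0
  have "1 \<le> (1 + 1 / \<beta>\<^sup>2) * (pi * fc2_coeff \<beta> 0)"
  proof -
    have "1 \<le> pi * fc2_coeff \<beta> 0"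
      by (simp add: fc2_coeff_def arcsin_coeff_def distrib_left)
    then have "1 * 1 \<le> (1 + 1 / \<beta>\<^sup>2) * (pi * fc2_coeff \<beta> 0)"
      by (intro mult_mono) auto
    then show ?thesis by simp
  qed
  then show ?thesis
    by (simp add: 0 lap_gap_coeff_def mult_ac)
next
  case (Suc m)
  let ?a = "arcsin_coeff (Suc m)" and ?b = "arcsin_coeff m"
  have nn: "0 \<le> ?a" "0 \<le> ?b" "0 \<le> integ_coeff arcsin_coeff (Suc m)"
    using arcsin_coeff_nonneg integ_arcsin_coeff_bounds(1) by auto
  have "lap_gap_coeff (Suc m) \<le> ?a + ?b"
    by (rule arcsin_coeff_pair_bounds)
  \<comment> \<open>Multiplied out, \<open>?a\<close> has the factor \<open>\<beta>^2 + 1\<close>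
    and \<open>?b\<close> the factor \<open>1 + 1 / \<beta>^2\<close>, both at least 1.\<close>
  also have "\<dots> \<le> (1 + 1 / \<beta>\<^sup>2) * (\<beta>\<^sup>2 * ?a + ?b)"
    using assms nn by (simp add: field_simps)
  also have "\<dots> \<le> (1 + 1 / \<beta>\<^sup>2) * (pi * fc2_coeff \<beta> (Suc m))"
  proof (rule mult_left_mono)
    have "pi * fc2_coeff \<beta> (Suc m)
        = (if m = 0 then pi else 0) + (\<beta>\<^sup>2 * ?a + ?b + integ_coeff arcsin_coeff (Suc m))"
      by (simp add: fc2_coeff_def distrib_left add_divide_distrib del: integ_coeff.simps)
    then show "\<beta>\<^sup>2 * ?a + ?b \<le> pi * fc2_coeff \<beta> (Suc m)"
      using nn by (auto simp del: integ_coeff.simps)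
  qed simp
  finally show ?thesis
    by (simp add: Suc mult_ac)
qed

text \<open>The constant is \<open>8 * (\<beta>^2 + 2) + 2\<close>: the first part comes from
  \<open>arcsin_coeff_pair_bounds\<close>, the final 2 pays for the linear term because
  \<open>lap_gap_coeff 1 = 1/2\<close>.\<close>

lemma fc2_coeff_upper:
  "fc2_coeff \<beta> n \<le> (8 * \<beta>\<^sup>2 + 18) * ((if n = 0 then 1 else 0) + lap_gap_coeff n)"
proof (cases n)
  case 0
  have "1 / pi \<le> 1"
    using pi_gt3 by simp
  then have "3/2 * \<beta>\<^sup>2 + 1/pi \<le> 8 * \<beta>\<^sup>2 + 18"
    using zero_le_power2[of \<beta>] by linarith
  then show ?thesis
    by (simp add: 0 fc2_coeff_def arcsin_coeff_def lap_gap_coeff_def)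
next
  case (Suc m)
  let ?a = "arcsin_coeff (Suc m)" and ?b = "arcsin_coeff m" and ?g = "lap_gap_coeff (Suc m)"
  have nn: "0 \<le> ?a" "0 \<le> ?b" "0 \<le> ?g"
    using arcsin_coeff_nonneg lap_gap_coeff_nonneg by auto
  have one: "(if Suc m = 1 then 1 else 0) \<le> 2 * ?g"
    using nn by (simp add: lap_gap_coeff_Suc)
  let ?s = "\<beta>\<^sup>2 * ?a + ?b + integ_coeff arcsin_coeff (Suc m)"
  have "0 \<le> ?s"
    using nn integ_arcsin_coeff_bounds(1)[of m] by auto
  then have "?s / pi \<le> ?s / 1"
    using pi_gt3 by (intro divide_left_mono) auto
  also have "\<dots> \<le> \<beta>\<^sup>2 * ?a + ?b + ?b"
    using integ_arcsin_coeff_bounds(2)[of m] by simp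
  also have "\<dots> \<le> (\<beta>\<^sup>2 + 2) * (?a + ?b)"
    using nn by (simp add: algebra_simps)
  also have "\<dots> \<le> (\<beta>\<^sup>2 + 2) * (8 * ?g)"
    by (intro mult_left_mono arcsin_coeff_pair_bounds) auto
  finally have "?s / pi \<le> (\<beta>\<^sup>2 + 2) * (8 * ?g)" .
  with one show ?thesis
    by (simp add: Suc fc2_coeff_def algebra_simps)
qed

lemma schoenberg_fc2_minus_lap_gap:
  assumes "0 < \<beta>"
  shows "schoenberg (\<lambda>t. pi * (1 + 1 / \<beta>\<^sup>2) * sphere_Theta \<beta> 1 t - (1 + lap_gap t))"
proof (rule schoenberg_power_series)
  let ?C = "pi * (1 + 1 / \<beta>\<^sup>2)"
  show "0 \<le> ?C * fc2_coeff \<beta> n - ((if n = 0 then 1 else 0) + lap_gap_coeff n)" for n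
    using fc2_coeff_lower[OF assms, of n] by simp
  show "continuous_on {-1..1} (\<lambda>t. ?C * sphere_Theta \<beta> 1 t - (1 + lap_gap t))"
    by (intro continuous_intros continuous_on_sphere_Theta_1)
  show "(\<lambda>n. (?C * fc2_coeff \<beta> n - ((if n = 0 then 1 else 0) + lap_gap_coeff n)) * t ^ n)
      sums (?C * sphere_Theta \<beta> 1 t - (1 + lap_gap t))" if "\<bar>t\<bar> < 1" for t
    using sums_diff[OF sums_mult[OF sums_sphere_Theta_1[OF that], of ?C] sums_one_plus_lap_gap[OF that]]
    by (simp only: left_diff_distrib mult.assoc)
qed

lemma schoenberg_lap_gap_minus_fc2:
  "schoenberg (\<lambda>t. (8 * \<beta>\<^sup>2 + 18) * (1 + lap_gap t) - sphere_Theta \<beta> 1 t)"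
proof (rule schoenberg_power_series)
  let ?C = "8 * \<beta>\<^sup>2 + 18"
  show "0 \<le> ?C * ((if n = 0 then 1 else 0) + lap_gap_coeff n) - fc2_coeff \<beta> n" for n
    using fc2_coeff_upper[of \<beta> n] by simp
  show "continuous_on {-1..1} (\<lambda>t. ?C * (1 + lap_gap t) - sphere_Theta \<beta> 1 t)"
    by (intro continuous_intros continuous_on_sphere_Theta_1)
  show "(\<lambda>n. (?C * ((if n = 0 then 1 else 0) + lap_gap_coeff n) - fc2_coeff \<beta> n) * t ^ n)
      sums (?C * (1 + lap_gap t) - sphere_Theta \<beta> 1 t)" if "\<bar>t\<bar> < 1" for t
    using sums_diff[OF sums_mult[OF sums_one_plus_lap_gap[OF that], of ?C] sums_sphere_Theta_1[OF that]]
    by (simp only: left_diff_distrib mult.assoc)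
qed

section \<open>The Laplace kernel\<close>

definition laplace_profile :: "real \<Rightarrow> real \<Rightarrow> real" where
  "laplace_profile c t = exp (- c * sqrt (1 - t))"

lemma laplace_profile_eq: "laplace_profile c t = exp (- c) * exp (c * lap_gap t)"
  by (simp add: laplace_profile_def exp_add[symmetric] algebra_simps)

lemma schoenberg_exp:
  assumes "schoenberg g" "0 \<le> c"
  shows "schoenberg (\<lambda>t. exp (c * g t))"
proof -
  have "schoenberg (\<lambda>t. (exp (c * g t) - 1 - c * g t) + (1 + c * g t))"
    using assms by (intro schoenberg.add schoenberg_exp_minus_linear schoenberg.const schoenberg_cmult) auto
  then show ?thesis
    by (rule schoenberg_cong) simp
qed

lemma schoenberg_laplace_profile: "0 \<le> c \<Longrightarrow> schoenberg (laplace_profile c)"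
  unfolding laplace_profile_eq[abs_def]
  by (intro schoenberg_cmult schoenberg_exp schoenberg_lap_gap) auto

lemma schoenberg_one_plus_lap_gap: "schoenberg (\<lambda>t. 1 + lap_gap t)"
  by (intro schoenberg.add schoenberg_lap_gap schoenberg.const) simp

text \<open>\<open>exp c\<close> cancels the prefactor, and \<open>(1 + 1 / c) * (1 + c * g)\<close>
  exceeds \<open>1 + g\<close> by \<open>1 / c + c * g\<close>.\<close>

lemma schoenberg_laplace_minus_lap_gap:
  assumes "0 < c"
  shows "schoenberg (\<lambda>t. exp c * (1 + 1 / c) * laplace_profile c t - (1 + lap_gap t))"
proof -
  have "schoenberg (\<lambda>t. (1 + 1 / c) * (exp (c * lap_gap t) - 1 - c * lap_gap t) + (1 / c + c * lap_gap t))"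
    using assms by (intro schoenberg.add schoenberg_cmult schoenberg_exp_minus_linear schoenberg_lap_gap
        schoenberg.const) auto
  then show ?thesis
  proof (rule schoenberg_cong)
    fix t
    have "exp c * (1 + 1 / c) * laplace_profile c t = (1 + 1 / c) * exp (c * lap_gap t)"
      by (simp add: laplace_profile_eq exp_minus)
    moreover have "(1 + 1 / c) * (E - 1 - c * g) + (1 / c + c * g) = (1 + 1 / c) * E - (1 + g)" for E g
      using assms by (simp add: field_simps)
    ultimately show "(1 + 1 / c) * (exp (c * lap_gap t) - 1 - c * lap_gap t) + (1 / c + c * lap_gap t)
        = exp c * (1 + 1 / c) * laplace_profile c t - (1 + lap_gap t)"
      by presburger
  qed
qed

text \<open>With \<open>K\<close> the factor of \<open>lap_gap\<close> in the exponential bound,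
  \<open>(1 + K) * (1 + g)\<close> exceeds \<open>1 + K * g\<close> by \<open>K + g\<close>.\<close>

lemma schoenberg_lap_gap_minus_laplace:
  assumes "0 \<le> c"
  shows "schoenberg (\<lambda>t. exp (- c) * (1 + (exp (2 * c) - 1) / 2) * (1 + lap_gap t) - laplace_profile c t)"
proof -
  let ?K = "(exp (2 * c) - 1) / 2"
  have "schoenberg (\<lambda>t. exp (- c) * ((1 + ?K * lap_gap t - exp (c * lap_gap t)) + (?K + lap_gap t)))"
    using assms by (intro schoenberg.add schoenberg_cmult schoenberg_linear_minus_exp_lap_gap
        schoenberg_lap_gap schoenberg.const) auto
  then show ?thesis
    by (rule schoenberg_cong) (simp only: laplace_profile_eq algebra_simps)
qed

section \<open>Assembly of the inclusions\<close>

theorem theorem4: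
  fixes c \<beta> :: real and L :: nat
  assumes "CARD('n::finite) \<ge> 2" and "c > 0" and "\<beta> > 0" and "L \<ge> 2"
  shows "rkhs (k_Lap c) (sphere (0::real^'n) 1) = rkhs (k_FC \<beta> 2) (sphere (0::real^'n) 1)
       \<and> rkhs (k_FC \<beta> 2) (sphere (0::real^'n) 1) \<subseteq> rkhs (k_FC \<beta> L) (sphere (0::real^'n) 1)"
proof -
  let ?S = "sphere (0::real^'n) 1"
  \<comment> \<open>The intermediate kernel: the Laplace and the two-layer spaces are each shown
    equal to its RKHS.\<close>
  let ?G = "\<lambda>x z :: real^'n. 1 + lap_gap (x \<bullet> z)"
  have S: "?S \<subseteq> cball 0 1"
    by auto
  have lap: "k_Lap c x z = laplace_profile c (x \<bullet> z)" for x z :: "real^'n"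
    by (simp add: k_Lap_def laplace_profile_def)
  have fc: "k_FC \<beta> m x z = sphere_Theta \<beta> (m - 1) (x \<bullet> z)" if "x \<in> ?S" "z \<in> ?S" for m x z
    using that by (simp add: k_FC_def ntk_Theta_sphere)
  have fc2: "k_FC \<beta> 2 x z = sphere_Theta \<beta> 1 (x \<bullet> z)" if "x \<in> ?S" "z \<in> ?S" for x z
    using fc[OF that, of 2] by simp
  have c: "0 \<le> c"
    using assms(2) by simp
  note G = schoenberg_one_plus_lap_gap and Lap = schoenberg_laplace_profile[OF c]
  have "rkhs (k_Lap c) ?S \<subseteq> rkhs ?G ?S"
    by (rule rkhs_schoenberg_subset[OF S Lap G _ schoenberg_lap_gap_minus_laplace[OF c] lap refl])
      (simp add: c)
  moreover have "rkhs ?G ?S \<subseteq> rkhs (k_Lap c) ?S"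
    by (rule rkhs_schoenberg_subset[OF S G Lap _ schoenberg_laplace_minus_lap_gap[OF assms(2)] refl lap])
      (simp add: c)
  moreover have "rkhs (k_FC \<beta> 2) ?S \<subseteq> rkhs ?G ?S"
    by (rule rkhs_schoenberg_subset[OF S schoenberg_sphere_Theta G _ schoenberg_lap_gap_minus_fc2 fc2 refl])
      simp_all
  moreover have "rkhs ?G ?S \<subseteq> rkhs (k_FC \<beta> 2) ?S"
    by (rule rkhs_schoenberg_subset[OF S G schoenberg_sphere_Theta _
          schoenberg_fc2_minus_lap_gap[OF assms(3)] refl fc2]) simp_all
  moreover have "rkhs (k_FC \<beta> 2) ?S \<subseteq> rkhs (k_FC \<beta> L) ?S"
  proof -
    \<comment> \<open>Then \<open>L - 1 = Suc n\<close>, so the growth lemma applies with the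
      constant \<open>2 ^ n\<close>.\<close>
    obtain n where L: "L = Suc (Suc n)"
      using assms(4) by (metis add_2_eq_Suc le_Suc_ex)
    have fcL: "k_FC \<beta> L x z = sphere_Theta \<beta> (Suc n) (x \<bullet> z)" if "x \<in> ?S" "z \<in> ?S" for x z
      using fc[OF that, of L] by (simp add: L)
    show ?thesis
      by (rule rkhs_schoenberg_subset[OF S schoenberg_sphere_Theta schoenberg_sphere_Theta
            _ schoenberg_sphere_Theta_growth fc2 fcL]) simp_all
  qed
  ultimately show ?thesis by blast
qed

end
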